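(* Let $n\ge1$ and let $a(z)=\sum_{k=0}^na_kz^k$, $b(z)=\sum_{k=0}^nb_kz^k$ be polynomials with $a_0=b_0=1$. Let $\gamma_1,\dots,\gamma_m$ be all the (distinct) common zeros in $\mathbb{C}$ of $\hat a$ and $\hat b$, with multiplicities $n_1,\dots,n_m$ (as common zeros). Let $\ell$ be the last standard basis vector of $\mathbb{R}^n$ and put $$v_k^j=(T_{\gamma_k}^jJ^{j-1})^\top\ell,\qquad k=1,\dots,m,\ j=1,\dots,n_k.$$ Then $\ker B(a,b)$ is the linear span of the vectors $v_k^j$.
   Context: $\hat a(z)=z^na(z^{-1})$ and $\hat b(z)=z^nb(z^{-1})$ are the reciprocal polynomials (monic of degree $n$). The multiplicity of a common zero is its multiplicity as a zero of $\gcd(\hat a,\hat b)$. With $u_n(z)=(1,z,\dots,z^{n-1})^\top$, the Bezout matrix $B(a,b)$ is the $n\times n$ matrix defined by $a(z)b(w)-a(w)b(z)=(z-w)\,u_n(z)^\top B(a,b)u_n(w)$; its kernel is taken in $\mathbb{C}^n$. For $\phi\in\mathbb{C}$, $T_\phi$ is the $n\times n$ lower triangular matrix with $(T_\phi)_{ij}=\phi^{i-j}$ for $i\ge j$ and $0$ otherwise (with $\phi^0=1$). $J$ is the $n\times n$ matrix with $J_{ij}=1$ if $i=j+1$ and $0$ otherwise. $^\top$ is transposition without conjugation. *)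

theory Defs
  imports
    "Jordan_Normal_Form.Matrix_Kernel"
    "HOL-Computational_Algebra.Polynomial_Factorial"
    "HOL-Computational_Algebra.Field_as_Ring"
begin

text \<open>The reciprocal is taken with respect to the nominal degree \<open>n\<close>, not the actual degree of the
  polynomial, so it differs from \<^const>\<open>reflect_poly\<close> when the coefficient of \<open>z^n\<close> vanishes.\<close>

definition recip_poly :: "nat \<Rightarrow> complex poly \<Rightarrow> complex poly" where
  "recip_poly n p = (\<Sum>k\<le>n. monom (coeff p k) (n - k))"

lemma poly_recip_poly:
  assumes "degree p \<le> n" "z \<noteq> 0"
  shows "poly (recip_poly n p) z = z ^ n * poly p (inverse z)"
proof -
  have "poly p (inverse z) = (\<Sum>k\<le>n. coeff p k * inverse z ^ k)"
    unfolding poly_altdef using assms(1)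
    by (intro sum.mono_neutral_left) (auto simp: coeff_eq_0 not_le)
  moreover have "z ^ n * (coeff p k * inverse z ^ k) = coeff p k * z ^ (n - k)" if "k \<le> n" for k
    using that assms(2) by (simp add: power_diff field_simps)
  ultimately have "z ^ n * poly p (inverse z) = (\<Sum>k\<le>n. coeff p k * z ^ (n - k))"
    by (simp only: sum_distrib_left) (intro sum.cong, auto)
  then show ?thesis
    by (simp add: recip_poly_def poly_sum poly_monom)
qed

lemma recip_poly_monic:
  assumes "coeff p 0 = 1"
  shows "degree (recip_poly n p) = n" "lead_coeff (recip_poly n p) = 1"
proof -
  have c: "coeff (recip_poly n p) n = 1"
  proof -
    have "coeff (recip_poly n p) n = (\<Sum>k\<le>n. if k = 0 then 1 else 0)"
      unfolding recip_poly_def coeff_sum using assms by (intro sum.cong) auto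
    then show ?thesis by simp
  qed
  have "degree (recip_poly n p) \<le> n"
    unfolding recip_poly_def
    by (intro degree_sum_le) (auto intro: order.trans[OF degree_monom_le])
  with c show d: "degree (recip_poly n p) = n"
    by (metis le_antisym le_degree zero_neq_one)
  with c show "lead_coeff (recip_poly n p) = 1" by simp
qed

definition power_vec :: "nat \<Rightarrow> complex \<Rightarrow> complex vec" where
  "power_vec n z = vec n (\<lambda>i. z ^ i)"

definition is_bezout_mat :: "nat \<Rightarrow> complex poly \<Rightarrow> complex poly \<Rightarrow> complex mat \<Rightarrow> bool" where
  "is_bezout_mat n a b B \<longleftrightarrow> B \<in> carrier_mat n n \<and>
     (\<forall>z w. poly a z * poly b w - poly a w * poly b z =
            (z - w) * (power_vec n z \<bullet> (B *\<^sub>v power_vec n w)))"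

definition bezout_mat :: "nat \<Rightarrow> complex poly \<Rightarrow> complex poly \<Rightarrow> complex mat" where
  "bezout_mat n a b = (THE B. is_bezout_mat n a b B)"

definition toep_mat :: "nat \<Rightarrow> complex \<Rightarrow> complex mat" where
  "toep_mat n \<phi> = mat n n (\<lambda>(i, j). if j \<le> i then \<phi> ^ (i - j) else 0)"

definition shift_mat :: "nat \<Rightarrow> complex mat" where
  "shift_mat n = mat n n (\<lambda>(i, j). if i = j + 1 then 1 else 0)"

text \<open>Vectors are indexed from \<open>0\<close>, so the last standard basis vector has index \<open>n - 1\<close>.\<close>

definition ker_vec :: "nat \<Rightarrow> complex \<Rightarrow> nat \<Rightarrow> complex vec" where
  "ker_vec n \<phi> j =
     transpose_mat (toep_mat n \<phi> ^\<^sub>m j * shift_mat n ^\<^sub>m (j - 1)) *\<^sub>v unit_vec n (n - 1)"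

abbreviation cspan :: "nat \<Rightarrow> complex vec set \<Rightarrow> complex vec set" where
  "cspan n \<equiv> LinearCombinations.module.span class_ring (module_vec TYPE(complex) n)"


lemma power_vec_form:
  assumes "B \<in> carrier_mat n n"
  shows "power_vec n z \<bullet> (B *\<^sub>v power_vec n w) = (\<Sum>p<n. \<Sum>q<n. B $$ (p, q) * z ^ p * w ^ q)"
  using assms
  by (auto simp: power_vec_def scalar_prod_def atLeast0LessThan sum_distrib_left mult_ac
      intro!: sum.cong)

definition bipoly :: "nat \<Rightarrow> (complex \<Rightarrow> complex \<Rightarrow> complex) \<Rightarrow> bool" where
  "bipoly n f \<longleftrightarrow> (\<exists>C. \<forall>z w. f z w = (\<Sum>p<n. \<Sum>q<n. C p q * z ^ p * w ^ q))"

lemma bipoly_sum: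
  assumes "\<And>i. i \<in> I \<Longrightarrow> bipoly n (f i)"
  shows "bipoly n (\<lambda>z w. \<Sum>i\<in>I. f i z w)"
proof -
  have "\<forall>i\<in>I. \<exists>C. \<forall>z w. f i z w = (\<Sum>p<n. \<Sum>q<n. C p q * z ^ p * w ^ q)"
    using assms unfolding bipoly_def by blast
  from bchoice[OF this] obtain C where C:
    "\<forall>i\<in>I. \<forall>z w. f i z w = (\<Sum>p<n. \<Sum>q<n. C i p q * z ^ p * w ^ q)" ..
  have "(\<Sum>i\<in>I. f i z w) = (\<Sum>p<n. \<Sum>q<n. (\<Sum>i\<in>I. C i p q) * z ^ p * w ^ q)" for z w
  proof -
    have "(\<Sum>i\<in>I. f i z w) = (\<Sum>i\<in>I. \<Sum>p<n. \<Sum>q<n. C i p q * z ^ p * w ^ q)"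
      using C by (intro sum.cong) auto
    also have "\<dots> = (\<Sum>p<n. \<Sum>i\<in>I. \<Sum>q<n. C i p q * z ^ p * w ^ q)"
      by (rule sum.swap)
    also have "\<dots> = (\<Sum>p<n. \<Sum>q<n. \<Sum>i\<in>I. C i p q * z ^ p * w ^ q)"
      by (intro sum.cong refl sum.swap)
    finally show ?thesis by (simp only: sum_distrib_right)
  qed
  then show ?thesis
    unfolding bipoly_def by (intro exI[of _ "\<lambda>p q. \<Sum>i\<in>I. C i p q"]) simp
qed

lemma bipoly_monom:
  assumes "r < n" "s < n"
  shows "bipoly n (\<lambda>z w. c * z ^ r * w ^ s)"
  unfolding bipoly_def
proof (intro exI allI)
  fix z w :: complex
  have "(\<Sum>p<n. \<Sum>q<n. (if p = r \<and> q = s then c else 0) * z ^ p * w ^ q)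
      = (\<Sum>p<n. if p = r then (\<Sum>q<n. if q = s then c * z ^ p * w ^ q else 0) else 0)"
  proof (intro sum.cong refl)
    fix p
    show "(\<Sum>q<n. (if p = r \<and> q = s then c else 0) * z ^ p * w ^ q)
        = (if p = r then (\<Sum>q<n. if q = s then c * z ^ p * w ^ q else 0) else 0)"
    proof (cases "p = r")
      case True
      have "(\<Sum>q<n. (if p = r \<and> q = s then c else 0) * z ^ p * w ^ q)
          = (\<Sum>q<n. if q = s then c * z ^ p * w ^ q else 0)"
        using True by (intro sum.cong refl) auto
      with True show ?thesis by (simp only: if_True simp_thms)
    qed simp
  qed
  also have "\<dots> = c * z ^ r * w ^ s"
    using assms by (simp only: sum.delta finite_lessThan lessThan_iff if_True)
  finally show "c * z ^ r * w ^ s =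
      (\<Sum>p<n. \<Sum>q<n. (if p = r \<and> q = s then c else 0) * z ^ p * w ^ q)" ..
qed

lemma bipoly_quotient_le:
  assumes "j \<le> i" "i \<le> n"
  shows "\<exists>g. bipoly n g \<and> (\<forall>z w. c * (z ^ i * w ^ j - w ^ i * z ^ j) = (z - w) * g z w)"
proof -
  define d where "d = i - j"
  define g where "g = (\<lambda>z w. \<Sum>r<d. c * z ^ (r + j) * w ^ (j + (d - Suc r)))"
  have "bipoly n g"
    unfolding g_def using assms by (intro bipoly_sum bipoly_monom) (auto simp: d_def)
  moreover have "c * (z ^ i * w ^ j - w ^ i * z ^ j) = (z - w) * g z w" for z w
  proof -
    have i: "i = d + j" using assms by (simp add: d_def)
    have "c * (z ^ i * w ^ j - w ^ i * z ^ j) = c * z ^ j * w ^ j * (z ^ d - w ^ d)"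
      by (simp add: i power_add algebra_simps)
    also have "\<dots> = (z - w) * g z w"
      unfolding power_diff_sumr2[of z d w] g_def
      by (simp only: sum_distrib_left power_add mult_ac)
    finally show ?thesis .
  qed
  ultimately show ?thesis by blast
qed

lemma bipoly_quotient:
  assumes "i \<le> n" "j \<le> n"
  shows "\<exists>g. bipoly n g \<and> (\<forall>z w. c * (z ^ i * w ^ j - w ^ i * z ^ j) = (z - w) * g z w)"
proof (cases "j \<le> i")
  case True
  then show ?thesis using bipoly_quotient_le assms by blast
next
  case False
  then have "\<exists>g. bipoly n g \<and> (\<forall>z w. (- c) * (z ^ j * w ^ i - w ^ j * z ^ i) = (z - w) * g z w)"
    using assms by (intro bipoly_quotient_le) auto
  moreover have "(- c) * (z ^ j * w ^ i - w ^ j * z ^ i) = c * (z ^ i * w ^ j - w ^ i * z ^ j)" for z w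
    by (simp add: algebra_simps)
  ultimately show ?thesis by metis
qed

lemma is_bezout_mat_exists:
  assumes "degree a \<le> n" "degree b \<le> n"
  shows "\<exists>B. is_bezout_mat n a b B"
proof -
  have poly: "poly p z = (\<Sum>k\<le>n. coeff p k * z ^ k)" if "degree p \<le> n" for p :: "complex poly" and z
    unfolding poly_altdef using that
    by (intro sum.mono_neutral_left) (auto simp: coeff_eq_0 not_le)
  define g where "g = (\<lambda>i j. SOME g. bipoly n g \<and>
      (\<forall>z w. coeff a i * coeff b j * (z ^ i * w ^ j - w ^ i * z ^ j) = (z - w) * g z w))"
  have g_spec: "bipoly n (g i j) \<and>
      (\<forall>z w. coeff a i * coeff b j * (z ^ i * w ^ j - w ^ i * z ^ j) = (z - w) * g i j z w)"
    if "i \<le> n" "j \<le> n" for i j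
    unfolding g_def by (rule someI_ex[OF bipoly_quotient[OF that]])
  have g: "bipoly n (g i j)" if "i \<in> {..n}" "j \<in> {..n}" for i j
    using g_spec[of i j] that by simp
  have eq: "coeff a i * coeff b j * (z ^ i * w ^ j - w ^ i * z ^ j) = (z - w) * g i j z w"
    if "i \<in> {..n}" "j \<in> {..n}" for i j z w
    using g_spec[of i j] that by simp
  have "bipoly n (\<lambda>z w. \<Sum>i\<le>n. \<Sum>j\<le>n. g i j z w)"
    by (intro bipoly_sum g)
  then obtain C where
    C: "\<And>z w. (\<Sum>i\<le>n. \<Sum>j\<le>n. g i j z w) = (\<Sum>p<n. \<Sum>q<n. C p q * z ^ p * w ^ q)"
    unfolding bipoly_def by blast
  define B where "B = mat n n (\<lambda>(p, q). C p q)"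
  have B: "B \<in> carrier_mat n n" by (simp add: B_def)
  have "poly a z * poly b w - poly a w * poly b z =
      (z - w) * (power_vec n z \<bullet> (B *\<^sub>v power_vec n w))" for z w
  proof -
    have "poly a z * poly b w - poly a w * poly b z =
        (\<Sum>i\<le>n. \<Sum>j\<le>n. coeff a i * coeff b j * (z ^ i * w ^ j - w ^ i * z ^ j))"
      by (simp add: poly[OF assms(1)] poly[OF assms(2)] sum_product right_diff_distrib
          sum_subtractf mult_ac)
    also have "\<dots> = (\<Sum>i\<le>n. \<Sum>j\<le>n. (z - w) * g i j z w)"
      by (intro sum.cong refl eq)
    also have "\<dots> = (z - w) * (\<Sum>p<n. \<Sum>q<n. C p q * z ^ p * w ^ q)"
      unfolding C[symmetric] by (simp only: sum_distrib_left)
    also have "(\<Sum>p<n. \<Sum>q<n. C p q * z ^ p * w ^ q) = power_vec n z \<bullet> (B *\<^sub>v power_vec n w)"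
      unfolding power_vec_form[OF B] by (simp add: B_def)
    finally show ?thesis .
  qed
  with B show ?thesis unfolding is_bezout_mat_def by blast
qed

lemma is_bezout_mat_unique:
  assumes "is_bezout_mat n a b B" "is_bezout_mat n a b B'"
  shows "B = B'"
proof -
  have B: "B \<in> carrier_mat n n" and B': "B' \<in> carrier_mat n n"
    using assms by (auto simp: is_bezout_mat_def)
  define D where "D = (\<lambda>p q. B $$ (p, q) - B' $$ (p, q))"
  have D: "(z - w) * (\<Sum>p<n. \<Sum>q<n. D p q * z ^ p * w ^ q) = 0" for z w
  proof -
    have "(z - w) * (power_vec n z \<bullet> (B *\<^sub>v power_vec n w)) =
        (z - w) * (power_vec n z \<bullet> (B' *\<^sub>v power_vec n w))"
      using assms unfolding is_bezout_mat_def by metis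
    then show ?thesis
      unfolding power_vec_form[OF B] power_vec_form[OF B'] D_def
      by (simp add: left_diff_distrib sum_subtractf right_diff_distrib)
  qed
  have coeffs: "c p = 0" if "\<And>z. (\<Sum>p<n. c p * z ^ p) = 0" "p < n" for c :: "nat \<Rightarrow> complex" and p
  proof -
    have "(\<Sum>p<n. monom (c p) p) = 0"
      using that(1) by (simp add: poly_sum poly_monom flip: poly_all_0_iff_0)
    then have "coeff (\<Sum>p<n. monom (c p) p) p = 0" by simp
    then show ?thesis using that(2) by (simp add: coeff_sum)
  qed
  have row: "(\<Sum>q<n. D p q * w ^ q) = 0" if "p < n" for p w
  proof -
    define Q where "Q = (\<Sum>p<n. monom (\<Sum>q<n. D p q * w ^ q) p)"
    have Q: "poly Q z = (\<Sum>p<n. (\<Sum>q<n. D p q * w ^ q) * z ^ p)" for z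
      by (simp add: Q_def poly_sum poly_monom)
    have "poly ([:- w, 1:] * Q) z = 0" for z
    proof -
      have "poly Q z = (\<Sum>p<n. \<Sum>q<n. D p q * z ^ p * w ^ q)"
        unfolding Q sum_distrib_right by (intro sum.cong refl) (simp only: mult_ac)
      moreover have "poly [:- w, 1:] z = z - w" by simp
      ultimately show ?thesis using D[of z w] by (simp only: poly_mult)
    qed
    then have "[:- w, 1:] * Q = 0"
      using poly_all_0_iff_0 by blast
    then have "Q = 0" by (metis mult_eq_0_iff one_neq_zero pCons_eq_0_iff)
    then have "(\<Sum>p<n. (\<Sum>q<n. D p q * w ^ q) * z ^ p) = 0" for z
      using Q by simp
    from coeffs[OF this that] show ?thesis .
  qed
  have "D p q = 0" if "p < n" "q < n" for p q
    using coeffs[OF row[OF that(1)] that(2)] .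
  then show ?thesis
    using B B' by (intro eq_matI) (auto simp: D_def)
qed

lemma bezout_mat:
  assumes "degree a \<le> n" "degree b \<le> n"
  shows "is_bezout_mat n a b (bezout_mat n a b)"
  unfolding bezout_mat_def
  by (rule theI', rule ex_ex1I, rule is_bezout_mat_exists[OF assms], erule is_bezout_mat_unique)

end

theory Submission
  imports
    Defs
    "HOL-Computational_Algebra.Formal_Power_Series"
    "HOL-Computational_Algebra.Fundamental_Theorem_Algebra"
begin

text \<open>A vector \<open>v\<close> is read as the functional \<open>L\<close> on polynomials of degree below \<open>n\<close> with
  \<open>L(w\<^sup>k) = v\<^bsub>n-1-k\<^esub>\<close>. For the reciprocals \<open>p = d f\<close>, \<open>q = d g\<close> with \<open>d\<close> their gcd, reversing the
  Bezoutian and applying \<open>L\<close> in \<open>w\<close> shows \<open>B v = 0\<close> iff \<open>p L[q] = q L[p]\<close>, where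
  \<open>L[p](z) = L\<^bsub>w\<^esub> ((p(z) - p(w)) / (z - w))\<close>. The vector \<open>v\<^sub>k\<^sup>j\<close> has
  \<open>L[p] = p / (z - \<gamma>\<^sub>k)\<^sup>j\<close>, so it lies in the kernel. Conversely, for \<open>v\<close> in the kernel
  \<open>f\<close> divides \<open>L[p]\<close>, hence \<open>L[p] = f h\<close> with \<open>deg h < deg d\<close>, and the partial fraction
  decomposition of \<open>h / d\<close> writes \<open>L[p]\<close> as a combination of the \<open>p / (z - \<gamma>\<^sub>k)\<^sup>j\<close>.
  As \<open>deg p = n\<close>, \<open>L[p]\<close> determines \<open>v\<close>.\<close>

subsection \<open>Associated polynomials of a linear functional\<close>

text \<open>This is L applied in w to (z^k - w^k) / (z - w). The recursion comes from z^(k+1) -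
  w^(k+1) = (z - w) w^k + z (z^k - w^k).\<close>

primrec assoc_monom :: "'a::comm_ring_1 fps \<Rightarrow> nat \<Rightarrow> 'a poly" where
  "assoc_monom S 0 = 0"
| "assoc_monom S (Suc k) = pCons (fps_nth S k) (assoc_monom S k)"

text \<open>The series \<open>S\<close> encodes the functional \<open>L\<close> with \<open>L (w ^ k) = fps_nth S k\<close>, and \<open>assoc S p\<close> is
  \<open>L\<close> applied in the variable \<open>w\<close> to \<open>(p(z) - p(w)) / (z - w)\<close>.\<close>

definition assoc :: "'a::comm_ring_1 fps \<Rightarrow> 'a poly \<Rightarrow> 'a poly" where
  "assoc S p = (\<Sum>k\<le>degree p. Polynomial.smult (coeff p k) (assoc_monom S k))"

text \<open>The functional L itself, evaluated at \<open>p\<close>.\<close>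

definition fps_pairing :: "'a::comm_ring_1 fps \<Rightarrow> 'a poly \<Rightarrow> 'a" where
  "fps_pairing S p = (\<Sum>k\<le>degree p. coeff p k * fps_nth S k)"

section \<open>Coefficients, linearity and recursion\<close>

lemma coeff_assoc_monom: "coeff (assoc_monom S k) i = (if i < k then fps_nth S (k - 1 - i) else 0)"
proof (induction k arbitrary: i)
  case (Suc k)
  then show ?case by (cases i) (auto simp: coeff_pCons)
qed simp

lemma assoc_eq:
  assumes "degree p \<le> n"
  shows "assoc S p = (\<Sum>k\<le>n. Polynomial.smult (coeff p k) (assoc_monom S k))"
  unfolding assoc_def using assms
  by (intro sum.mono_neutral_left) (auto simp: coeff_eq_0 not_le)

lemma fps_pairing_eq:
  assumes "degree p \<le> n"
  shows "fps_pairing S p = (\<Sum>k\<le>n. coeff p k * fps_nth S k)"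
  unfolding fps_pairing_def using assms
  by (intro sum.mono_neutral_left) (auto simp: coeff_eq_0 not_le)

lemma coeff_assoc:
  assumes "degree p \<le> n"
  shows "coeff (assoc S p) i = (\<Sum>k\<in>{i<..n}. coeff p k * fps_nth S (k - 1 - i))"
  unfolding assoc_eq[OF assms] coeff_sum
  by (rule sum.mono_neutral_cong_right) (auto simp: coeff_assoc_monom)

text \<open>The difference quotient of \<open>p\<close> has degree below \<open>n\<close> in w, so L
  is only evaluated at powers below w^n. This later lets the series of a vector replace an
  untruncated one.\<close>

lemma assoc_cong:
  assumes "degree p \<le> n" "\<And>k. k < n \<Longrightarrow> fps_nth S k = fps_nth S' k"
  shows "assoc S p = assoc S' p"
  by (rule poly_eqI) (auto simp: coeff_assoc[OF assms(1)] assms(2) intro!: sum.cong)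

lemma coeff_assoc_eq_0:
  assumes "degree p \<le> i"
  shows "coeff (assoc S p) i = 0"
  using assms by (simp add: coeff_assoc[of p "degree p"])

lemma assoc_0_left [simp]: "assoc 0 p = 0"
  by (rule poly_eqI) (simp add: coeff_assoc[of p "degree p"])

lemma assoc_add_left: "assoc (S + S') p = assoc S p + assoc S' p"
  by (rule poly_eqI) (simp add: coeff_assoc[of p "degree p"] algebra_simps sum.distrib)

lemma assoc_smult_left: "assoc (fps_const c * S) p = Polynomial.smult c (assoc S p)"
  by (rule poly_eqI) (simp add: coeff_assoc[of p "degree p"] sum_distrib_left mult_ac)

lemma assoc_diff_left: "assoc (S - S') p = assoc S p - assoc S' p"
  by (rule poly_eqI) (simp add: coeff_assoc[of p "degree p"] algebra_simps sum_subtractf)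

lemma assoc_add_right: "assoc S (p + q) = assoc S p + assoc S q"
proof -
  let ?n = "max (degree p) (degree q)"
  have "degree (p + q) \<le> ?n" by (rule degree_add_le_max)
  then show ?thesis
    by (simp add: assoc_eq[of _ ?n] smult_add_left sum.distrib)
qed

lemma fps_pairing_add: "fps_pairing S (p + q) = fps_pairing S p + fps_pairing S q"
proof -
  let ?n = "max (degree p) (degree q)"
  have "degree (p + q) \<le> ?n" by (rule degree_add_le_max)
  then show ?thesis
    by (simp add: fps_pairing_eq[of _ ?n] distrib_right sum.distrib)
qed

lemma fps_pairing_smult: "fps_pairing S (Polynomial.smult c p) = c * fps_pairing S p"
  using degree_smult_le[of c p] by (simp add: fps_pairing_eq[of _ "degree p"] sum_distrib_left mult_ac)

lemma fps_pairing_diff: "fps_pairing S (p - q) = fps_pairing S p - fps_pairing S q"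
  using fps_pairing_add[of S "p - q" q] by simp

lemma fps_pairing_0 [simp]: "fps_pairing S 0 = 0"
  by (simp add: fps_pairing_def)

lemma assoc_0_right [simp]: "assoc S 0 = 0"
  by (simp add: assoc_def)

lemma fps_pairing_pCons:
  "fps_pairing S (pCons c p) = c * fps_nth S 0 + fps_pairing (fps_shift 1 S) p"
proof -
  have "degree (pCons c p) \<le> Suc (degree p)" by (simp add: degree_pCons_le)
  then have "fps_pairing S (pCons c p) =
      (\<Sum>k\<le>Suc (degree p). coeff (pCons c p) k * fps_nth S k)"
    by (rule fps_pairing_eq)
  then show ?thesis
    by (simp add: fps_pairing_def sum.atMost_Suc_shift del: sum.atMost_Suc)
qed

lemma fps_pairing_monom: "fps_pairing S (monom x k) = x * fps_nth S k"
  by (induction k arbitrary: S) (simp_all add: monom_0 monom_Suc fps_pairing_pCons)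

lemma fps_pairing_sum: "fps_pairing S (\<Sum>i\<in>I. h i) = (\<Sum>i\<in>I. fps_pairing S (h i))"
  by (induction I rule: infinite_finite_induct) (simp_all add: fps_pairing_add)

text \<open>Apply L to the identity z p(z) - w p(w) = (z - w) p(w) + z (p(z) - p(w)) divided by z -
  w; the constant \<open>c\<close> cancels.\<close>

lemma assoc_pCons: "assoc S (pCons c p) = pCons (fps_pairing S p) (assoc S p)"
proof -
  have "degree (pCons c p) \<le> Suc (degree p)" by (simp add: degree_pCons_le)
  then have "assoc S (pCons c p) =
      (\<Sum>k\<le>degree p. Polynomial.smult (coeff p k) (pCons (fps_nth S k) (assoc_monom S k)))"
    by (simp add: assoc_eq[of _ "Suc (degree p)"] sum.atMost_Suc_shift del: sum.atMost_Suc)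
  also have "\<dots> = pCons (fps_pairing S p) (assoc S p)"
  proof (rule poly_eqI)
    show "coeff (\<Sum>k\<le>degree p. Polynomial.smult (coeff p k) (pCons (fps_nth S k) (assoc_monom S k))) i =
        coeff (pCons (fps_pairing S p) (assoc S p)) i" for i
      by (cases i) (simp_all add: coeff_sum fps_pairing_def assoc_def)
  qed
  finally show ?thesis .
qed

text \<open>For fixed z, the quotient (p(w) - p(z)) / (w - z) is \<open>synthetic_div p z\<close> as
  a polynomial in w.\<close>

lemma poly_assoc: "poly (assoc S p) z = fps_pairing S (synthetic_div p z)"
proof (induction p)
  case (pCons c p)
  have "fps_pairing S (p + Polynomial.smult z (synthetic_div p z)) =
      fps_pairing S (pCons (poly p z) (synthetic_div p z))"
    by (simp only: synthetic_div_correct)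
  then show ?case
    by (simp add: assoc_pCons pCons.IH synthetic_div_pCons fps_pairing_add fps_pairing_smult)
qed simp

section \<open>Linear factors, poles and partial fractions\<close>

definition linear_adjoint :: "'a::comm_ring_1 \<Rightarrow> 'a fps \<Rightarrow> 'a fps" where
  "linear_adjoint c S = fps_shift 1 ((1 - fps_const c * fps_X) * S)"

lemma linear_adjoint_nth: "fps_nth (linear_adjoint c S) k = fps_nth S (Suc k) - c * fps_nth S k"
  by (simp add: linear_adjoint_def left_diff_distrib mult.assoc fps_mult_fps_X_commute)

lemma fps_pairing_linear_mult:
  "fps_pairing S ([:- c, 1:] * q) = fps_pairing (linear_adjoint c S) q"
proof -
  have "[:- c, 1:] * q = Polynomial.smult (- c) q + pCons 0 q" by simp
  then have "fps_pairing S ([:- c, 1:] * q) =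
      (\<Sum>k\<le>degree q. coeff q k * (fps_nth S (Suc k) - c * fps_nth S k))"
    by (simp only: fps_pairing_add fps_pairing_smult fps_pairing_pCons)
      (simp add: fps_pairing_def right_diff_distrib sum_subtractf sum_distrib_left sum_negf mult_ac)
  then show ?thesis
    by (simp add: fps_pairing_def linear_adjoint_nth)
qed

text \<open>Divide (z - c) q(z) - (w - c) q(w) = (z - w) q(z) + (w - c) (q(z) - q(w)) by z - w and
  apply L. The series \<open>linear_adjoint c S\<close> encodes the functional sending r to L((w -
  c) r).\<close>

lemma assoc_linear_mult:
  "assoc S ([:- c, 1:] * q) =
    Polynomial.smult (fps_nth S 0) q + assoc (linear_adjoint c S) q"
proof (induction q)
  case (pCons x q)
  have "[:- c, 1:] * pCons x q = pCons 0 ([:- c, 1:] * q) + [:- c * x, x:]"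
    by (simp add: algebra_simps)
  then have "assoc S ([:- c, 1:] * pCons x q) =
      assoc S (pCons 0 ([:- c, 1:] * q)) + assoc S [:- c * x, x:]"
    by (simp only: assoc_add_right)
  also have "\<dots> = pCons (fps_pairing (linear_adjoint c S) q)
       (Polynomial.smult (fps_nth S 0) q + assoc (linear_adjoint c S) q) + [:x * fps_nth S 0:]"
    by (simp only: assoc_pCons pCons.IH fps_pairing_linear_mult) (simp add: fps_pairing_pCons)
  finally show ?case by (simp add: assoc_pCons mult.commute)
qed simp

text \<open>\<open>x\<^bsup>j-1\<^esup> / (1 - c x)\<^sup>j\<close>, which encodes the expansion of \<open>1 / (z - c)\<^sup>j\<close> at infinity.\<close>

definition pole_series :: "'a::field \<Rightarrow> nat \<Rightarrow> 'a fps" where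
  "pole_series c j = Abs_fps (\<lambda>k. c ^ k) ^ j * fps_X ^ (j - 1)"

lemma geometric_fps: "(1 - fps_const c * fps_X) * Abs_fps (\<lambda>k. c ^ k :: 'a::field) = 1"
proof (rule fps_ext)
  show "fps_nth ((1 - fps_const c * fps_X) * Abs_fps (\<lambda>k. c ^ k)) k = fps_nth 1 k" for k
    by (cases k) (simp_all add: left_diff_distrib mult.assoc)
qed

text \<open>Multiplying 1 / (z - c)^j by z - c lowers the pole order by one; for j = 1 only a
  polynomial part remains, which the shift discards.\<close>

lemma linear_adjoint_pole_series:
  "linear_adjoint c (pole_series c 1) = 0"
  "linear_adjoint c (pole_series c (Suc (Suc j))) = pole_series c (Suc j)"
proof -
  let ?F = "Abs_fps (\<lambda>k. c ^ k)"
  show "linear_adjoint c (pole_series c 1) = 0"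
    by (simp add: linear_adjoint_def pole_series_def geometric_fps)
       (rule fps_ext, simp)
  have "(1 - fps_const c * fps_X) * pole_series c (Suc (Suc j)) =
      ((1 - fps_const c * fps_X) * ?F) * (?F ^ Suc j * fps_X ^ j) * fps_X"
    by (simp only: pole_series_def power_Suc diff_Suc_1 mult_ac)
  then have "(1 - fps_const c * fps_X) * pole_series c (Suc (Suc j)) =
      pole_series c (Suc j) * fps_X"
    by (simp only: geometric_fps pole_series_def diff_Suc_1 mult_1_left)
  then show "linear_adjoint c (pole_series c (Suc (Suc j))) = pole_series c (Suc j)"
    by (simp only: linear_adjoint_def fps_shift_times_fps_X')
qed

text \<open>Each linear factor lowers the pole order by one. The term with L(1) vanishes until the
  pole is simple; then L(1) = 1 and the remaining functional is zero, which leaves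
  \<open>q\<close>.\<close>

lemma assoc_pole_series: "assoc (pole_series c (Suc j)) ([:- c, 1:] ^ Suc j * q) = q"
proof (induction j)
  case 0
  have "fps_nth (pole_series c 1) 0 = 1" by (simp add: pole_series_def)
  then show ?case
    using assoc_linear_mult[of "pole_series c 1" c q] linear_adjoint_pole_series(1)[of c] by simp
next
  case (Suc j)
  have "fps_nth (pole_series c (Suc (Suc j))) 0 = 0" by (simp add: pole_series_def)
  moreover have "[:- c, 1:] ^ Suc (Suc j) * q = [:- c, 1:] * ([:- c, 1:] ^ Suc j * q)"
    by (simp only: power_Suc mult_ac)
  ultimately show ?case
    by (simp only: assoc_linear_mult linear_adjoint_pole_series Suc.IH) simp
qed

text \<open>Read from the top degree down, the coefficients of \<open>assoc S p\<close> form a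
  triangular system in the coefficients of \<open>S\<close>, with the leading coefficient of
  \<open>p\<close> on the diagonal.\<close>

lemma assoc_eq_0D:
  fixes p :: "'a::idom poly"
  assumes "assoc S p = 0" "k < degree p"
  shows "fps_nth S k = 0"
  using assms(2)
proof (induction k rule: less_induct)
  case (less k)
  define n where "n = degree p"
  define i where "i = n - 1 - k"
  have i: "i < n" "n - 1 - i = k" using less.prems by (auto simp: i_def n_def)
  have "0 = (\<Sum>r\<in>{i<..n}. coeff p r * fps_nth S (r - 1 - i))"
    using coeff_assoc[of p n S i] assms(1) by (simp add: n_def)
  also have "\<dots> = (\<Sum>r\<in>{n}. coeff p r * fps_nth S (r - 1 - i))"
    using i less.prems by (intro sum.mono_neutral_right) (auto intro!: less.IH simp: n_def)
  finally have "coeff p n * fps_nth S k = 0" using i by simp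
  moreover have "coeff p n \<noteq> 0" using less.prems by (auto simp: n_def)
  ultimately show ?case by simp
qed

text \<open>Partial fractions for h / d, multiplied by d f so that only polynomials occur: the
  generators d f / (z - c)^(j+1) lie in the subspace \<open>W\<close>. The induction splits off a
  pole of top order at a root of \<open>d\<close>.\<close>

lemma pole_decomposition:
  fixes d f h :: "'a::alg_closed_field poly"
  assumes zero: "0 \<in> W"
    and add: "\<And>p q. p \<in> W \<Longrightarrow> q \<in> W \<Longrightarrow> p + q \<in> W"
    and smult: "\<And>c p. p \<in> W \<Longrightarrow> Polynomial.smult c p \<in> W"
    and pole: "\<And>c j q. d = [:- c, 1:] ^ Suc j * q \<Longrightarrow> q * f \<in> W"
    and "degree h < degree d"
  shows "h * f \<in> W"
  using pole assms(5)
proof (induction "degree d" arbitrary: d f h)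
  case (Suc r)
  have d0: "d \<noteq> 0" using Suc.prems(2) by auto
  have "degree d > 0" using Suc.prems(2) by simp
  then obtain c where c: "poly d c = 0" using alg_closed_imp_poly_has_root by blast
  define j where "j = order c d - 1"
  have o: "order c d = Suc j" using c d0 by (simp add: j_def order_root)
  obtain e where e: "d = [:- c, 1:] ^ Suc j * e" "\<not> [:- c, 1:] dvd e"
    using order_decomp[OF d0, of c] o by auto
  define d' where "d' = [:- c, 1:] ^ j * e"
  have d': "d = [:- c, 1:] * d'" by (simp only: e(1) d'_def power_Suc mult_ac)
  have "d' \<noteq> 0" using d0 d' by auto
  then have deg: "degree d = Suc (degree d')" unfolding d' by (subst degree_mult_eq) auto
  have ec: "poly e c \<noteq> 0" using e(2) by (simp add: poly_eq_0_iff_dvd)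
  \<comment> \<open>This is the coefficient of 1 / (z - c)^(j+1) in h / d; subtracting that term
    makes the numerator vanish at \<open>c\<close>.\<close>
  define x where "x = poly h c / poly e c"
  have "poly (h - Polynomial.smult x e) c = 0" using ec by (simp add: x_def)
  then obtain h' where h': "h - Polynomial.smult x e = [:- c, 1:] * h'"
    unfolding poly_eq_0_iff_dvd by (rule dvdE)
  have split: "h * f = Polynomial.smult x (e * f) + h' * ([:- c, 1:] * f)"
  proof -
    have "h = Polynomial.smult x e + [:- c, 1:] * h'" using h' by (simp only: diff_eq_eq add.commute)
    then have "h * f = (Polynomial.smult x e + [:- c, 1:] * h') * f" by simp
    then show ?thesis by (simp only: distrib_right mult_smult_left) (simp only: mult_ac)
  qed
  have "e * f \<in> W" using Suc.prems(1) e(1) by blast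
  moreover have "h' * ([:- c, 1:] * f) \<in> W"
  proof (cases "h' = 0")
    case False
    have "e \<noteq> 0" using ec by auto
    moreover have deg_pow: "degree ([:- c, 1:] ^ Suc j) = Suc j" by (rule degree_linear_power)
    moreover have "[:- c, 1:] ^ Suc j \<noteq> 0" using deg_pow by (metis degree_0 nat.distinct(1))
    ultimately have "degree ([:- c, 1:] ^ Suc j * e) = Suc j + degree e"
      using degree_mult_eq by metis
    then have "degree e < degree d" by (simp only: e(1))
    moreover have "degree (h - Polynomial.smult x e) \<le> max (degree h) (degree e)"
      by (rule order.trans[OF degree_diff_le_max]) (auto intro: degree_smult_le le_max_iff_disj)
    ultimately have "degree ([:- c, 1:] * h') < degree d"
      using Suc.prems(2) by (simp only: h')
    then have "degree h' < degree d'" using False deg by (subst (asm) degree_mult_eq) auto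
    \<comment> \<open>The factor z - c moves from \<open>d\<close> to \<open>f\<close>, so the
      product d f is unchanged and every pole of \<open>d'\<close> yields a generator already
      available.\<close>
    moreover have "q * ([:- c, 1:] * f) \<in> W" if "d' = [:- b, 1:] ^ Suc i * q" for b i q
    proof -
      have "d = [:- b, 1:] ^ Suc i * ([:- c, 1:] * q)" by (simp only: d' that mult_ac)
      from Suc.prems(1)[OF this] show ?thesis by (simp only: mult_ac)
    qed
    moreover have "r = degree d'" using Suc.hyps(2) deg by simp
    ultimately show ?thesis using Suc.hyps(1) by blast
  qed (use zero in simp)
  ultimately show ?case unfolding split by (intro add smult)
qed simp


subsection \<open>The kernel vectors as Toeplitz rows\<close>

definition fps_toeplitz :: "nat \<Rightarrow> 'a::comm_ring_1 fps \<Rightarrow> 'a mat" where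
  "fps_toeplitz n F = mat n n (\<lambda>(i, j). if j \<le> i then fps_nth F (i - j) else 0)"

text \<open>Lower triangularity restricts the inner index to the range from column to row, where the
  sum is a Cauchy product.\<close>

lemma fps_toeplitz_mult: "fps_toeplitz n F * fps_toeplitz n G = fps_toeplitz n (F * G)"
proof (rule eq_matI)
  fix i l
  assume "i < dim_row (fps_toeplitz n (F * G))" "l < dim_col (fps_toeplitz n (F * G))"
  then have il: "i < n" "l < n" by (auto simp: fps_toeplitz_def)
  have "(fps_toeplitz n F * fps_toeplitz n G) $$ (i, l) =
      (\<Sum>k<n. (if k \<le> i then fps_nth F (i - k) else 0) * (if l \<le> k then fps_nth G (k - l) else 0))"
    using il by (simp add: fps_toeplitz_def scalar_prod_def atLeast0LessThan)
  also have "\<dots> = (\<Sum>k\<in>{l..i}. fps_nth F (i - k) * fps_nth G (k - l))"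
    using il by (intro sum.mono_neutral_cong_right) auto
  also have "\<dots> = fps_toeplitz n (F * G) $$ (i, l)"
  proof (cases "l \<le> i")
    case True
    then have "(\<Sum>k\<in>{l..i}. fps_nth F (i - k) * fps_nth G (k - l)) =
        (\<Sum>r=0..i - l. fps_nth F r * fps_nth G (i - l - r))"
      by (intro sum.reindex_bij_witness[of _ "\<lambda>r. i - r" "\<lambda>k. i - k"]) auto
    with il True show ?thesis by (simp add: fps_toeplitz_def fps_mult_nth)
  qed (use il in \<open>simp add: fps_toeplitz_def\<close>)
  finally show "(fps_toeplitz n F * fps_toeplitz n G) $$ (i, l) =
      fps_toeplitz n (F * G) $$ (i, l)" .
qed (simp_all add: fps_toeplitz_def)

lemma fps_toeplitz_power: "fps_toeplitz n F ^\<^sub>m k = fps_toeplitz n (F ^ k)"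
proof (induction k)
  case 0
  show ?case by (rule eq_matI) (auto simp: fps_toeplitz_def)
next
  case (Suc k)
  then show ?case by (simp add: fps_toeplitz_mult mult.commute)
qed

text \<open>T and J are the Toeplitz matrices of the geometric series and of \<open>fps_X\<close>,
  so their product is that of \<open>pole_series c j\<close>; the transpose applied to the last unit
  vector picks its last row.\<close>

lemma ker_vec_eq:
  assumes "n \<ge> 1"
  shows "ker_vec n c j = vec n (\<lambda>i. fps_nth (pole_series c j) (n - 1 - i))"
proof -
  have T: "toep_mat n c = fps_toeplitz n (Abs_fps (\<lambda>k. c ^ k))"
    by (rule eq_matI) (auto simp: toep_mat_def fps_toeplitz_def)
  have J: "shift_mat n = fps_toeplitz n fps_X"
    by (rule eq_matI) (auto simp: shift_mat_def fps_toeplitz_def fps_X_def)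
  show ?thesis
    unfolding ker_vec_def T J fps_toeplitz_power fps_toeplitz_mult pole_series_def[symmetric]
    using assms by (intro eq_vecI) (auto simp: fps_toeplitz_def)
qed

subsection \<open>The kernel of the Bezout matrix\<close>

text \<open>The reversal matches the reversal of coefficients in \<^const>\<open>recip_poly\<close>.\<close>

definition rev_series :: "complex vec \<Rightarrow> complex fps" where
  "rev_series v = Abs_fps (\<lambda>k. if k < dim_vec v then vec_index v (dim_vec v - 1 - k) else 0)"

lemma rev_series_nth:
  "fps_nth (rev_series v) k = (if k < dim_vec v then vec_index v (dim_vec v - 1 - k) else 0)"
  by (simp add: rev_series_def)

lemma rev_series_add:
  assumes "v \<in> carrier_vec n" "w \<in> carrier_vec n"
  shows "rev_series (v + w) = rev_series v + rev_series w"
  using assms by (intro fps_ext) (auto simp: rev_series_nth)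

lemma rev_series_smult: "rev_series (c \<cdot>\<^sub>v v) = fps_const c * rev_series v"
  by (intro fps_ext) (auto simp: rev_series_nth)

lemma rev_series_zero: "rev_series (0\<^sub>v n) = 0"
  by (intro fps_ext) (auto simp: rev_series_nth)

lemma degree_recip_poly: "degree (recip_poly n p) \<le> n"
  unfolding recip_poly_def
  by (intro degree_sum_le) (auto intro: order.trans[OF degree_monom_le])

lemma poly_eqI_nonzero:
  fixes p q :: "complex poly"
  assumes "\<And>z. z \<noteq> 0 \<Longrightarrow> poly p z = poly q z"
  shows "p = q"
proof -
  have "poly ([:0, 1:] * (p - q)) z = 0" for z using assms[of z] by (cases "z = 0") auto
  then have "[:0, 1:] * (p - q) = 0" using poly_all_0_iff_0 by blast
  then show ?thesis by simp
qed

lemma poly_diff_synthetic_div: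
  "p - [:poly p z:] = [:- z, 1:] * synthetic_div p z" for p :: "'a::comm_ring_1 poly"
  using synthetic_div_correct'[of z p] by (simp add: algebra_simps)

text \<open>Substituting 1/z and 1/w in the Bezout identity and multiplying by (z w)^n gives the
  identity for the reciprocals, with both indices of \<open>B\<close> reversed. Applying L in w then
  produces the entries of B v.\<close>

lemma bezout_reversed:
  assumes B: "is_bezout_mat n a b B" and deg: "degree a \<le> n" "degree b \<le> n"
    and v: "v \<in> carrier_vec n"
  defines "S \<equiv> rev_series v"
  shows "(\<Sum>p<n. monom (vec_index (B *\<^sub>v v) p) (n - 1 - p)) =
    recip_poly n a * assoc S (recip_poly n b) - recip_poly n b * assoc S (recip_poly n a)"
proof (rule poly_eqI_nonzero)
  fix z :: complex
  assume z: "z \<noteq> 0"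
  let ?a = "recip_poly n a" and ?b = "recip_poly n b"
  have Bc: "B \<in> carrier_mat n n" using B by (simp add: is_bezout_mat_def)
  \<comment> \<open>The reversed Bezoutian as a polynomial in w, for fixed z.\<close>
  define K where "K = (\<Sum>q<n. monom (\<Sum>p<n. B $$ (p, q) * z ^ (n - 1 - p)) (n - 1 - q))"
  \<comment> \<open>One factor z w is spent on 1/z - 1/w = (w - z) / (z w), which leaves the
    exponents n - 1 - p and n - 1 - q.\<close>
  have rev: "(z * w) ^ n * ((inverse z - inverse w) * (x * inverse z ^ p * inverse w ^ q)) =
      (w - z) * (x * z ^ (n - 1 - p) * w ^ (n - 1 - q))"
    if w: "w \<noteq> 0" and "p < n" "q < n" for w x p q
  proof -
    have "n = Suc p + (n - 1 - p)" "n = Suc q + (n - 1 - q)" using that by auto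
    then have "z ^ n = z * z ^ p * z ^ (n - 1 - p)" "w ^ n = w * w ^ q * w ^ (n - 1 - q)"
      by (metis power_Suc power_add)+
    then show ?thesis using z w by (simp add: power_mult_distrib field_simps)
  qed
  have "[:- z, 1:] * K = Polynomial.smult (poly ?a z) ?b - Polynomial.smult (poly ?b z) ?a"
  proof (rule poly_eqI_nonzero)
    fix w :: complex
    assume w: "w \<noteq> 0"
    have "poly ?a z * poly ?b w - poly ?b z * poly ?a w =
        (z * w) ^ n * (poly a (inverse z) * poly b (inverse w) - poly a (inverse w) * poly b (inverse z))"
      using z w deg by (simp add: poly_recip_poly power_mult_distrib algebra_simps)
    also have "\<dots> = (z * w) ^ n * ((inverse z - inverse w) *
        (\<Sum>p<n. \<Sum>q<n. B $$ (p, q) * inverse z ^ p * inverse w ^ q))"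
      using B unfolding power_vec_form[OF Bc, symmetric] by (simp only: is_bezout_mat_def)
    also have "\<dots> = (\<Sum>p<n. \<Sum>q<n. (w - z) * (B $$ (p, q) * z ^ (n - 1 - p) * w ^ (n - 1 - q)))"
      by (simp only: sum_distrib_left) (intro sum.cong refl rev, use w in auto)
    also have "\<dots> = (w - z) * poly K w"
      unfolding K_def poly_sum poly_monom sum_distrib_left sum_distrib_right by (rule sum.swap)
    finally show "poly ([:- z, 1:] * K) w =
        poly (Polynomial.smult (poly ?a z) ?b - Polynomial.smult (poly ?b z) ?a) w"
      by (simp add: algebra_simps)
  qed
  \<comment> \<open>The two subtracted constants cancel, and each difference is now divisible by w -
    z.\<close>
  also have "\<dots> = Polynomial.smult (poly ?a z) (?b - [:poly ?b z:]) -
      Polynomial.smult (poly ?b z) (?a - [:poly ?a z:])"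
    by (simp add: smult_diff_right algebra_simps)
  also have "\<dots> = [:- z, 1:] * (Polynomial.smult (poly ?a z) (synthetic_div ?b z) -
      Polynomial.smult (poly ?b z) (synthetic_div ?a z))"
    unfolding poly_diff_synthetic_div by (simp only: mult_smult_right right_diff_distrib)
  finally have K: "K = Polynomial.smult (poly ?a z) (synthetic_div ?b z) -
      Polynomial.smult (poly ?b z) (synthetic_div ?a z)"
    by (subst (asm) mult_left_cancel) auto
  have "fps_pairing S K = (\<Sum>q<n. (\<Sum>p<n. B $$ (p, q) * z ^ (n - 1 - p)) * vec_index v q)"
    unfolding K_def fps_pairing_sum fps_pairing_monom S_def
    using v by (intro sum.cong refl) (auto simp: rev_series_nth)
  also have "\<dots> = (\<Sum>p<n. \<Sum>q<n. B $$ (p, q) * vec_index v q * z ^ (n - 1 - p))"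
    unfolding sum_distrib_right by (subst sum.swap) (simp only: mult_ac)
  also have "\<dots> = (\<Sum>p<n. vec_index (B *\<^sub>v v) p * z ^ (n - 1 - p))"
    using Bc v by (intro sum.cong refl)
      (auto simp: scalar_prod_def atLeast0LessThan sum_distrib_right)
  finally show "poly (\<Sum>p<n. monom (vec_index (B *\<^sub>v v) p) (n - 1 - p)) z =
      poly (?a * assoc S ?b - ?b * assoc S ?a) z"
    by (simp add: K fps_pairing_diff fps_pairing_smult poly_assoc poly_sum poly_monom)
qed

lemma bezout_kernel_iff:
  assumes "is_bezout_mat n a b B" "degree a \<le> n" "degree b \<le> n" and v: "v \<in> carrier_vec n"
  shows "v \<in> mat_kernel B \<longleftrightarrow> recip_poly n a * assoc (rev_series v) (recip_poly n b) =
    recip_poly n b * assoc (rev_series v) (recip_poly n a)"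
proof -
  let ?P = "\<Sum>p<n. monom (vec_index (B *\<^sub>v v) p) (n - 1 - p)"
  have Bc: "B \<in> carrier_mat n n" using assms(1) by (simp add: is_bezout_mat_def)
  have "B *\<^sub>v v = 0\<^sub>v n \<longleftrightarrow> ?P = 0"
  proof
    assume P: "?P = 0"
    show "B *\<^sub>v v = 0\<^sub>v n"
    proof (rule eq_vecI)
      fix r
      assume "r < dim_vec (0\<^sub>v n)"
      then have r: "r < n" by simp
      have "0 = coeff ?P (n - 1 - r)" by (simp only: P coeff_0)
      also have "\<dots> = (\<Sum>p<n. if p = r then vec_index (B *\<^sub>v v) p else 0)"
        unfolding coeff_sum using r by (intro sum.cong) auto
      also have "\<dots> = vec_index (B *\<^sub>v v) r" using r by simp
      finally show "vec_index (B *\<^sub>v v) r = vec_index (0\<^sub>v n) r" using r by simp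
    qed (use Bc in simp)
  qed simp
  then show ?thesis
    using bezout_reversed[OF assms] v by (simp add: mat_kernel[OF Bc])
qed


theorem corollary3p3:
  fixes n m :: nat
    and a b :: "complex poly"
    and \<gamma> :: "nat \<Rightarrow> complex"
    and N :: "nat \<Rightarrow> nat"
  assumes "n \<ge> 1"
    and "degree a \<le> n" "degree b \<le> n"
    and "coeff a 0 = 1" "coeff b 0 = 1"
    and "inj_on \<gamma> {1..m}"
    and "\<gamma> ` {1..m} = {z. poly (recip_poly n a) z = 0 \<and> poly (recip_poly n b) z = 0}"
    and "\<And>k. k \<in> {1..m} \<Longrightarrow> N k = order (\<gamma> k) (gcd (recip_poly n a) (recip_poly n b))"
  shows "mat_kernel (bezout_mat n a b) =
    cspan n {ker_vec n (\<gamma> k) j | k j. k \<in> {1..m} \<and> j \<in> {1..N k}}"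
proof -
  interpret V: vec_space "TYPE(complex)" n .
  let ?B = "bezout_mat n a b" and ?a = "recip_poly n a" and ?b = "recip_poly n b"
  define X where "X = {ker_vec n (\<gamma> k) j | k j. k \<in> {1..m} \<and> j \<in> {1..N k}}"
  define d where "d = gcd ?a ?b"
  have B: "is_bezout_mat n a b ?B" by (rule bezout_mat[OF assms(2,3)])
  then have Bc: "?B \<in> carrier_mat n n" by (simp add: is_bezout_mat_def)
  note ker_iff = bezout_kernel_iff[OF B assms(2,3)]
  have dega: "degree ?a = n" using recip_poly_monic[OF assms(4)] by simp
  have degb: "degree ?b = n" using recip_poly_monic[OF assms(5)] by simp
  have a0: "?a \<noteq> 0" using dega assms(1) by auto
  have d0: "d \<noteq> 0" using a0 by (simp add: d_def)
  have Xc: "X \<subseteq> carrier_vec n"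
    by (auto simp: X_def ker_vec_eq[OF assms(1)])
  \<comment> \<open>The vector keeps only the first \<open>n\<close> coefficients of the pole
    series, which suffices since \<open>p\<close> has degree at most \<open>n\<close>.\<close>
  have assoc_ker_vec: "assoc (rev_series (ker_vec n c (Suc j))) p = q"
    if "p = [:- c, 1:] ^ Suc j * q" "degree p \<le> n" for c j p q
  proof -
    have "assoc (rev_series (ker_vec n c (Suc j))) p = assoc (pole_series c (Suc j)) p"
      using that(2) by (rule assoc_cong) (simp add: rev_series_nth ker_vec_eq[OF assms(1)])
    then show ?thesis using assoc_pole_series that(1) by simp
  qed
  have "X \<subseteq> mat_kernel ?B"
  proof
    fix v
    assume v: "v \<in> X"
    then obtain k i where k: "k \<in> {1..m}" and i: "1 \<le> i" "i \<le> N k" "v = ker_vec n (\<gamma> k) i"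
      unfolding X_def by auto
    then obtain j where j: "Suc j \<le> N k" and v_eq: "v = ker_vec n (\<gamma> k) (Suc j)"
      by (cases i) auto
    have "[:- \<gamma> k, 1:] ^ Suc j dvd d"
      using j assms(8)[OF k] by (simp only: d_def order_divides) simp
    then have "[:- \<gamma> k, 1:] ^ Suc j dvd ?a" "[:- \<gamma> k, 1:] ^ Suc j dvd ?b"
      by (auto simp: d_def intro: dvd_trans)
    then obtain q r where q: "?a = [:- \<gamma> k, 1:] ^ Suc j * q" and r: "?b = [:- \<gamma> k, 1:] ^ Suc j * r"
      by (auto elim!: dvdE)
    have "assoc (rev_series v) ?a = q" "assoc (rev_series v) ?b = r"
      unfolding v_eq by (rule assoc_ker_vec, fact, rule degree_recip_poly)+
    moreover have "?a * r = ?b * q" by (simp only: q r mult_ac)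
    ultimately show "v \<in> mat_kernel ?B"
      using ker_iff[of v] v Xc by auto
  qed
  moreover have "submodule class_ring (mat_kernel ?B) V.V"
    unfolding submodule_def
    using V.module_axioms Bc mult_add_distrib_mat_vec[OF Bc] mult_mat_vec[OF Bc]
    by (auto simp: mat_kernel[OF Bc])
  ultimately have "V.span X \<subseteq> mat_kernel ?B" by (rule V.span_is_subset)
  moreover have "mat_kernel ?B \<subseteq> V.span X"
  proof
    fix v
    assume "v \<in> mat_kernel ?B"
    then have v: "v \<in> carrier_vec n"
      and eq: "?a * assoc (rev_series v) ?b = ?b * assoc (rev_series v) ?a"
      using ker_iff mat_kernel_carrier[OF Bc] by auto
    define A where "A = assoc (rev_series v) ?a"
    \<comment> \<open>The polynomials L[\<open>?a\<close>] reached from the span; the aim is to show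
      that \<open>A\<close> is one of them.\<close>
    define W where "W = (\<lambda>w. assoc (rev_series w) ?a) ` V.span X"
    obtain f g where f: "?a = f * d" and g: "?b = g * d" and cop: "coprime f g"
      using gcd_coprime_exists[of ?a ?b] d0 unfolding d_def by auto
    have "d * (f * assoc (rev_series v) ?b) = d * (g * A)"
      using eq unfolding A_def[symmetric] by (subst (asm) (1) f, subst (asm) (1) g) (simp only: mult_ac)
    then have "f * assoc (rev_series v) ?b = g * A" using d0 by simp
    then have "f dvd g * A" by (metis dvd_triv_left)
    then have "f dvd A" using cop by (simp add: coprime_dvd_mult_right_iff)
    then obtain h where h: "A = h * f" by (metis dvd_def mult.commute)
    have W0: "0 \<in> W"
      unfolding W_def by (rule image_eqI[of _ _ "0\<^sub>v n"]) (use V.span_zero in \<open>auto simp: rev_series_zero\<close>)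
    have spanc: "V.span X \<subseteq> carrier_vec n" using V.span_is_subset2[OF Xc] by simp
    have "A \<in> W"
    proof (cases "h = 0")
      case False
      have "f \<noteq> 0" using f a0 by auto
      have A0: "A \<noteq> 0" using False h \<open>f \<noteq> 0\<close> by simp
      \<comment> \<open>As \<open>?a\<close> = f d has degree \<open>n\<close> and A = h f, this
        makes the fraction h / d proper.\<close>
      have "degree A < n"
      proof (rule ccontr)
        assume "\<not> degree A < n"
        then have "coeff A (degree A) = 0" unfolding A_def
          by (intro coeff_assoc_eq_0) (simp add: dega)
        then show False using A0 by simp
      qed
      then have "degree h < degree d"
        using dega h f False d0 \<open>f \<noteq> 0\<close> by (simp add: degree_mult_eq)
      have "h * f \<in> W"
      proof (rule pole_decomposition[OF W0 _ _ _ \<open>degree h < degree d\<close>])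
        fix p q
        assume "p \<in> W" "q \<in> W"
        then obtain x y where xy: "x \<in> V.span X" "y \<in> V.span X"
          "p = assoc (rev_series x) ?a" "q = assoc (rev_series y) ?a" by (auto simp: W_def)
        then have "p + q = assoc (rev_series (x + y)) ?a"
          using spanc by (subst rev_series_add[of _ n]) (auto simp: assoc_add_left)
        then show "p + q \<in> W" using V.span_add1[OF _ xy(1,2)] Xc by (auto simp: W_def)
      next
        fix c p
        assume "p \<in> W"
        then obtain x where x: "x \<in> V.span X" "p = assoc (rev_series x) ?a" by (auto simp: W_def)
        then have "Polynomial.smult c p = assoc (rev_series (c \<cdot>\<^sub>v x)) ?a"
          by (simp add: rev_series_smult assoc_smult_left)
        then show "Polynomial.smult c p \<in> W" using V.smult_in_span[OF Xc x(1)] by (auto simp: W_def)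
      next
        fix c j q
        assume q: "d = [:- c, 1:] ^ Suc j * q"
        \<comment> \<open>Such a factorization forces \<open>c\<close> to be a common zero of
          multiplicity at least \<open>Suc j\<close>, so the matching vector is among the
          generators.\<close>
        have "poly d c = 0" by (simp add: q)
        then have "poly ?a c = 0" "poly ?b c = 0" by (simp_all only: f g poly_mult mult_zero_right)
        then have "c \<in> \<gamma> ` {1..m}" unfolding assms(7) by simp
        then obtain k where k: "k \<in> {1..m}" "c = \<gamma> k" by blast
        have "[:- c, 1:] ^ Suc j dvd d" by (simp only: q dvd_triv_left)
        then have "Suc j \<le> N k" using d0 assms(8)[OF k(1)] by (simp only: order_divides k(2) d_def) simp
        then have "ker_vec n c (Suc j) \<in> X" using k by (force simp: X_def)
        then have "ker_vec n c (Suc j) \<in> V.span X" using V.in_own_span Xc by auto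
        moreover have "?a = [:- c, 1:] ^ Suc j * (q * f)" unfolding f by (subst q) (simp only: mult_ac)
        then have "assoc (rev_series (ker_vec n c (Suc j))) ?a = q * f"
          by (rule assoc_ker_vec) (simp add: dega)
        ultimately show "q * f \<in> W" unfolding W_def by (intro image_eqI) auto
      qed
      then show ?thesis by (simp add: h)
    qed (use W0 h in simp)
    then obtain x where x: "x \<in> V.span X" "A = assoc (rev_series x) ?a" by (auto simp: W_def)
    then have xc: "x \<in> carrier_vec n" using spanc by auto
    \<comment> \<open>Since \<open>?a\<close> has degree exactly \<open>n\<close>,
      L[\<open>?a\<close>] determines the first \<open>n\<close> coefficients of the series, hence
      all entries of the vector.\<close>
    have "assoc (rev_series v - rev_series x) ?a = 0"
      using x(2) by (simp add: assoc_diff_left A_def)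
    from assoc_eq_0D[OF this] have nth: "fps_nth (rev_series v) k = fps_nth (rev_series x) k" if "k < n" for k
      using that by (simp add: dega)
    have "v = x"
    proof (rule eq_vecI)
      fix i
      assume "i < dim_vec x"
      then show "vec_index v i = vec_index x i"
        using nth[of "n - 1 - i"] v xc by (simp add: rev_series_nth)
    qed (use v xc in simp)
    then show "v \<in> V.span X" using x(1) by simp
  qed
  ultimately show ?thesis unfolding X_def by (rule subset_antisym[rotated])
qed

end
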